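(* If $X$ is a 3D rep-tile, then its boundary $\partial X$ is connected.
   Context: A set $X \subset \mathbb{R}^3$ with non-empty interior is a $3$-dimensional $k$-index rep-tile if there are sets $X_1,\dots,X_k$ with pairwise disjoint interiors and $X=\bigcup_{i=1}^k X_i$ such that the $X_i$ are mutually congruent and each is similar to $X$. A 3D rep-tile is a $3$-dimensional $k$-index rep-tile with $k>1$ that is a piecewise linear embedding of a compact connected 3-manifold in $\mathbb{R}^3$. *)

theory Defs
  imports "HOL-Analysis.Analysis"
begin

definition isometry3 :: "(real^3 \<Rightarrow> real^3) \<Rightarrow> bool" where
  "isometry3 f \<longleftrightarrow> (\<forall>x y. dist (f x) (f y) = dist x y)"

definition similarity3 :: "(real^3 \<Rightarrow> real^3) \<Rightarrow> bool" where
  "similarity3 f \<longleftrightarrow> (\<exists>r>0. \<forall>x y. dist (f x) (f y) = r * dist x y)"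

definition congruent3 :: "(real^3) set \<Rightarrow> (real^3) set \<Rightarrow> bool" where
  "congruent3 A B \<longleftrightarrow> (\<exists>f. isometry3 f \<and> f ` A = B)"

definition similar3 :: "(real^3) set \<Rightarrow> (real^3) set \<Rightarrow> bool" where
  "similar3 A B \<longleftrightarrow> (\<exists>f. similarity3 f \<and> f ` A = B)"

definition rep_tile_index :: "nat \<Rightarrow> (real^3) set \<Rightarrow> bool" where
  "rep_tile_index k X \<longleftrightarrow> interior X \<noteq> {} \<and>
     (\<exists>Xs :: nat \<Rightarrow> (real^3) set.
        X = (\<Union>i<k. Xs i) \<and>
        (\<forall>i<k. \<forall>j<k. i \<noteq> j \<longrightarrow> interior (Xs i) \<inter> interior (Xs j) = {}) \<and>
        (\<forall>i<k. \<forall>j<k. congruent3 (Xs i) (Xs j)) \<and>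
        (\<forall>i<k. similar3 (Xs i) X))"

definition polyhedron3 :: "(real^3) set \<Rightarrow> bool" where
  "polyhedron3 X \<longleftrightarrow> (\<exists>T. finite T \<and> (\<forall>S\<in>T. \<exists>P. finite P \<and> S = convex hull P) \<and> X = \<Union>T)"

definition half_space3 :: "(real^3) set" where
  "half_space3 = {y. y $ 1 \<ge> 0}"

definition manifold3 :: "(real^3) set \<Rightarrow> bool" where
  "manifold3 X \<longleftrightarrow> (\<forall>x\<in>X. \<exists>U V. openin (top_of_set X) U \<and> x \<in> U \<and>
       openin (top_of_set half_space3) V \<and> U homeomorphic V)"

text \<open>3D rep-tile: a k-index rep-tile with k > 1 which is a PL embedded compact connected
  3-manifold, i.e. a compact connected polyhedron that is a 3-manifold with boundary.\<close>
definition rep_tile_3D :: "(real^3) set \<Rightarrow> bool" where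
  "rep_tile_3D X \<longleftrightarrow> (\<exists>k>1. rep_tile_index k X) \<and>
     polyhedron3 X \<and> compact X \<and> connected X \<and> manifold3 X"

end

theory Submission
  imports Defs
begin

text \<open>Suppose that the complement of the tile \<open>X\<close> is disconnected, so that \<open>X\<close> has holes (bounded
  complementary components). There are finitely many of them, so let \<open>H\<close> be one of least diameter.
  A tile \<open>Y = g ` X\<close> of the subdivision has the smaller hole \<open>g ` H\<close>; by minimality this is no hole
  of \<open>X\<close>, so it meets another tile \<open>Z\<close>. The interior of \<open>Z\<close> is connected because \<open>X\<close> is a manifold,
  hence it lies inside \<open>g ` H\<close>. Being congruent to \<open>Y\<close>, the tile \<open>Z\<close> must then have the same
  outer boundary as \<open>Y\<close>, and near a generic point of it the two polyhedra overlap. So the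
  complement is connected, and unicoherence of Euclidean space gives the theorem.\<close>

subsection \<open>Isometries and similarities\<close>

text \<open>A point \<open>x\<close> of \<open>K\<close> missed by \<open>f\<close> has distance at
  least some \<open>d > 0\<close> from the closed image of \<open>K\<close>. Its iterates are then
  pairwise at distance at least \<open>d\<close>, which sequential compactness forbids.\<close>

lemma compact_isometry_into_imp_onto:
  fixes f :: "'a::metric_space \<Rightarrow> 'a"
  assumes "compact K" and into: "f ` K \<subseteq> K"
    and iso: "\<And>x y. x \<in> K \<Longrightarrow> y \<in> K \<Longrightarrow> dist (f x) (f y) = dist x y"
  shows "f ` K = K"
proof (rule ccontr)
  assume "f ` K \<noteq> K"
  then obtain x where x: "x \<in> K" "x \<notin> f ` K" using into by blast
  have cont: "continuous_on K f"
    using iso by (auto simp: continuous_on_iff)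
  then have "closed (f ` K)"
    by (simp add: assms(1) compact_continuous_image compact_imp_closed)
  then obtain d where d: "d > 0" "ball x d \<subseteq> - f ` K"
    using x(2) open_contains_ball[of "- f ` K"] by (meson ComplI open_Compl)
  define s where "s n = (f ^^ n) x" for n
  have sK: "s n \<in> K" for n
    unfolding s_def by (induction n) (use x into in auto)
  \<comment> \<open>Since \<open>f\<close> preserves distances on \<open>K\<close>, distances along
    the orbit depend only on the difference of the indices.\<close>
  have shift: "dist (s (n + m)) (s n) = dist (s m) x" for n m
    by (induction n) (use iso sK in \<open>auto simp: s_def\<close>)
  have far: "d \<le> dist (s m) (s n)" if "n < m" for n m
  proof -
    from that obtain k where k: "m = n + Suc k" by (auto simp: less_iff_Suc_add)
    have "dist (s m) (s n) = dist (s (Suc k)) x" unfolding k by (rule shift)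
    moreover have "s (Suc k) \<in> f ` K" using sK[of k] by (simp add: s_def)
    ultimately show ?thesis using d(2) by (force simp: dist_commute not_less subset_iff)
  qed
  obtain l r where "strict_mono r" "(s \<circ> r) \<longlonglongrightarrow> l"
    using \<open>compact K\<close> sK unfolding compact_def by blast
  then have "Cauchy (s \<circ> r)" using LIMSEQ_imp_Cauchy by blast
  then obtain M where M: "\<And>m n. m \<ge> M \<Longrightarrow> n \<ge> M \<Longrightarrow> dist ((s \<circ> r) m) ((s \<circ> r) n) < d"
    using \<open>d > 0\<close> unfolding Cauchy_def by blast
  have "r M < r (Suc M)" using \<open>strict_mono r\<close> by (simp add: strict_mono_Suc_iff)
  with far M[of "Suc M" M] show False by force
qed

locale similarity =
  fixes g :: "'a::euclidean_space \<Rightarrow> 'a" and r :: real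
  assumes ratio_pos: "r > 0" and dist_image: "dist (g x) (g y) = r * dist x y"
begin

lemma inj: "inj g"
proof (rule injI)
  fix x y assume "g x = g y"
  then have "r * dist x y = 0" using dist_image[of x y] by simp
  then show "x = y" using ratio_pos by simp
qed

text \<open>Scaling \<open>g x - g 0\<close> by \<open>1 / r\<close> leaves an isometry fixing the
  origin, which is automatically linear. Surjectivity, continuity and preservation of convexity are
  read off from this form.\<close>

lemma affine_form:
  obtains h where "orthogonal_transformation h" "g = (\<lambda>x. g 0 + r *\<^sub>R h x)"
proof
  define h where "h x = (1 / r) *\<^sub>R (g x - g 0)" for x
  have "dist (h x) (h y) = dist x y" for x y
  proof -
    have "h x - h y = (1 / r) *\<^sub>R (g x - g y)"
      by (simp add: h_def algebra_simps)
    then have "dist (h x) (h y) = dist (g x) (g y) / r"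
      using ratio_pos by (simp add: dist_norm)
    then show ?thesis using dist_image ratio_pos by simp
  qed
  then show "orthogonal_transformation h"
    by (simp add: orthogonal_transformation_isometry h_def)
  show "g = (\<lambda>x. g 0 + r *\<^sub>R h x)"
    using ratio_pos by (auto simp: h_def)
qed

lemma bij: "bij g"
proof -
  obtain h where h: "orthogonal_transformation h" "g = (\<lambda>x. g 0 + r *\<^sub>R h x)"
    using affine_form .
  have "\<exists>x. g x = y" for y
  proof -
    obtain x where "h x = (1 / r) *\<^sub>R (y - g 0)"
      using orthogonal_transformation_surj[OF h(1)] by (metis surjD)
    then have "g x = y" using ratio_pos by (subst h(2)) simp
    then show ?thesis ..
  qed
  then show ?thesis using inj by (metis bijI surj_def)
qed

lemma inv_apply [simp]: "inv g (g x) = x" "g (inv g x) = x"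
  using bij by (simp_all add: bij_is_inj bij_is_surj surj_f_inv_f)

lemma inv_image [simp]: "inv g ` g ` S = S" "g ` inv g ` S = S"
  by (auto simp: image_image)

lemma inverse: "similarity (inv g) (1 / r)"
proof
  show "1 / r > 0" using ratio_pos by simp
  fix x y
  show "dist (inv g x) (inv g y) = 1 / r * dist x y"
    using dist_image[of "inv g x" "inv g y"] ratio_pos by (simp add: field_simps)
qed

lemma continuous_on: "continuous_on S g"
proof -
  obtain h where h: "orthogonal_transformation h" "g = (\<lambda>x. g 0 + r *\<^sub>R h x)"
    using affine_form .
  have "continuous_on S h"
    using h(1) by (simp add: linear_continuous_on linear_linear orthogonal_transformation_linear)
  then show ?thesis by (subst h(2)) (intro continuous_intros)
qed

lemma compact_image: "compact S \<Longrightarrow> compact (g ` S)"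
  by (simp add: compact_continuous_image continuous_on)

lemma connected_image: "connected S \<Longrightarrow> connected (g ` S)"
  by (simp add: connected_continuous_image continuous_on)

lemma convex_image: 
  assumes "convex S" shows "convex (g ` S)"
proof -
  obtain h where h: "orthogonal_transformation h" "g = (\<lambda>x. g 0 + r *\<^sub>R h x)"
    using affine_form .
  have "g ` S = (+) (g 0) ` (*\<^sub>R) r ` h ` S"
    by (subst h(2)) (simp add: image_image)
  then show ?thesis
    using assms h(1)
    by (simp add: convex_linear_image convex_scaling convex_translation
        orthogonal_transformation_linear)
qed

lemma bounded_image:
  assumes "bounded S" shows "bounded (g ` S)"
proof -
  obtain a e where "\<And>x. x \<in> S \<Longrightarrow> dist a x \<le> e"
    using assms unfolding bounded_def by blast
  then have "dist (g a) y \<le> r * e" if "y \<in> g ` S" for y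
    using that dist_image ratio_pos by (auto simp: mult_left_mono)
  then show ?thesis unfolding bounded_def by blast
qed

lemma open_image: "open S \<Longrightarrow> open (g ` S)"
  using invariance_of_domain[OF continuous_on _ inj_on_subset[OF inj subset_UNIV]] .

lemma interior_image: "interior (g ` S) = g ` interior S"
proof
  show "g ` interior S \<subseteq> interior (g ` S)"
    by (simp add: interior_maximal image_mono interior_subset open_image)
  interpret i: similarity "inv g" "1 / r" by (rule inverse)
  have "inv g ` interior (g ` S) \<subseteq> inv g ` g ` S"
    using interior_subset by (rule image_mono)
  then have "inv g ` interior (g ` S) \<subseteq> interior S"
    by (simp add: interior_maximal i.open_image)
  then have "g ` inv g ` interior (g ` S) \<subseteq> g ` interior S" by (rule image_mono)
  then show "interior (g ` S) \<subseteq> g ` interior S" by simp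
qed

lemma image_Compl: "g ` (- S) = - g ` S"
  by (rule bij_image_Compl_eq[OF bij])

lemma frontier_image: "frontier (g ` S) = g ` frontier S"
  unfolding frontier_def closure_interior
  by (metis image_Compl image_set_diff[OF inj] interior_image)

lemma diameter_image:
  assumes "bounded S" shows "diameter (g ` S) = r * diameter S"
proof (rule antisym)
  show "diameter (g ` S) \<le> r * diameter S"
  proof (rule diameter_le)
    show "g ` S \<noteq> {} \<or> 0 \<le> r * diameter S"
      using ratio_pos diameter_ge_0[OF assms] by simp
    fix x y assume "x \<in> g ` S" "y \<in> g ` S"
    then show "norm (x - y) \<le> r * diameter S"
      using diameter_bounded_bound[OF assms] ratio_pos dist_image
      by (auto simp flip: dist_norm)
  qed
  have "diameter S \<le> diameter (g ` S) / r"
  proof (rule diameter_le)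
    show "S \<noteq> {} \<or> 0 \<le> diameter (g ` S) / r"
      using ratio_pos diameter_ge_0[OF bounded_image[OF assms]] by simp
    fix x y assume "x \<in> S" "y \<in> S"
    then have "dist (g x) (g y) \<le> diameter (g ` S)"
      using diameter_bounded_bound[OF bounded_image[OF assms]] by blast
    then show "norm (x - y) \<le> diameter (g ` S) / r"
      using ratio_pos dist_image by (simp add: dist_norm field_simps)
  qed
  then show "r * diameter S \<le> diameter (g ` S)"
    using ratio_pos by (simp add: field_simps)
qed

text \<open>An unbounded component of the complement goes to a connected set avoiding the image of
  \<open>S\<close>, and this set is unbounded because \<open>inv g\<close> preserves boundedness.
  The same inclusion for \<open>inv g\<close> then yields equality.\<close>

lemma image_outside_subset: "g ` outside S \<subseteq> outside (g ` S)"
proof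
  interpret i: similarity "inv g" "1 / r" by (rule inverse)
  fix y assume "y \<in> g ` outside S"
  then obtain x where x: "x \<in> outside S" "y = g x" by blast
  let ?C = "connected_component_set (- S) x"
  have "\<not> bounded ?C" and "x \<notin> S" using x(1) by (auto simp: outside_def)
  then have "x \<in> ?C" by simp
  have "g ` ?C \<subseteq> connected_component_set (- g ` S) y"
  proof (rule connected_component_maximal)
    show "y \<in> g ` ?C" using \<open>x \<in> ?C\<close> x(2) by blast
    show "g ` ?C \<subseteq> - g ` S"
      unfolding image_Compl[symmetric] by (rule image_mono[OF connected_component_subset])
  qed (simp add: connected_image)
  moreover have "\<not> bounded (g ` ?C)"
    using \<open>\<not> bounded ?C\<close> i.bounded_image[of "g ` ?C"] by auto
  ultimately show "y \<in> outside (g ` S)"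
    unfolding outside using bounded_subset by blast
qed

lemma outside_image: "outside (g ` S) = g ` outside S"
proof
  interpret i: similarity "inv g" "1 / r" by (rule inverse)
  have "inv g ` outside (g ` S) \<subseteq> outside S"
    using i.image_outside_subset[of "g ` S"] by simp
  then have "g ` inv g ` outside (g ` S) \<subseteq> g ` outside S" by (rule image_mono)
  then show "outside (g ` S) \<subseteq> g ` outside S" by simp
qed (rule image_outside_subset)

end


subsection \<open>Bounded complementary components\<close>

text \<open>For closed \<open>X\<close> these are exactly the bounded components of the complement.
  Phrased through the frontier, the property passes from a tile to a larger set as soon as
  \<open>H\<close> is disjoint from that set.\<close>

definition hole :: "'a::euclidean_space set \<Rightarrow> 'a set \<Rightarrow> bool" where
  "hole X H \<longleftrightarrow> H \<noteq> {} \<and> open H \<and> connected H \<and> bounded H \<and> H \<inter> X = {} \<and> frontier H \<subseteq> X"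

lemma (in similarity) hole_image: "hole X H \<Longrightarrow> hole (g ` X) (g ` H)"
  unfolding hole_def
  by (auto simp: open_image connected_image bounded_image frontier_image inj_eq[OF inj])

text \<open>A connected set that meets \<open>H\<close> without lying in it would cross the frontier
  of \<open>H\<close>, which is part of \<open>X\<close>.\<close>

lemma hole_connected_subset:
  assumes "hole X H" "connected C" "C \<inter> X = {}" "C \<inter> H \<noteq> {}"
  shows "C \<subseteq> H"
proof -
  have "C \<inter> frontier H = {}" using assms unfolding hole_def by blast
  then show ?thesis using connected_Int_frontier[OF assms(2,4)] by blast
qed

lemma hole_in_components:
  assumes "hole X H" shows "H \<in> components (- X)"
proof -
  have "H \<subseteq> - X" "connected H" "H \<noteq> {}" using assms unfolding hole_def by auto
  moreover have "D = H" if "D \<noteq> {}" "H \<subseteq> D" "D \<subseteq> - X" "connected D" for D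
  proof -
    have "D \<subseteq> H"
      using hole_connected_subset[OF assms, of D] that \<open>H \<noteq> {}\<close> by blast
    with that(2) show ?thesis by blast
  qed
  ultimately show ?thesis unfolding in_components_maximal by blast
qed

lemma hole_Int_outside:
  assumes "hole X H" shows "H \<inter> outside X = {}"
proof (rule ccontr)
  assume "H \<inter> outside X \<noteq> {}"
  then obtain x where x: "x \<in> H" "x \<in> outside X" by blast
  let ?C = "connected_component_set (- X) x"
  have "x \<notin> X" and unb: "\<not> bounded ?C" using x(2) by (auto simp: outside_def)
  have "?C \<inter> X = {}" using connected_component_subset[of "- X" x] by blast
  moreover have "x \<in> ?C" using \<open>x \<notin> X\<close> by simp
  then have "?C \<inter> H \<noteq> {}" using x(1) by blast
  ultimately have "?C \<subseteq> H"
    using hole_connected_subset[OF assms connected_connected_component] by blast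
  then show False using unb assms bounded_subset unfolding hole_def by blast
qed

text \<open>In dimension at least two the outside of a bounded set is connected, so a disconnected
  complement must have a nonempty inside as well.\<close>

lemma hole_exists:
  fixes X :: "'a::euclidean_space set"
  assumes "compact X" "2 \<le> DIM('a)" "\<not> connected (- X)"
  obtains H where "hole X H"
proof -
  have "bounded X" "closed X" using assms compact_imp_bounded compact_imp_closed by auto
  have "inside X \<noteq> {}"
  proof
    assume "inside X = {}"
    then have "- X = outside X" using outside_inside[of X] by simp
    then show False using assms connected_outside[OF \<open>bounded X\<close>] by simp
  qed
  then obtain x where x: "x \<notin> X" "bounded (connected_component_set (- X) x)"
    unfolding inside_def by blast
  let ?H = "connected_component_set (- X) x"
  have comp: "?H \<in> components (- X)" using x(1) by (simp add: componentsI)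
  have "hole X ?H"
    unfolding hole_def
  proof (intro conjI)
    show "?H \<noteq> {}" using x(1) by (simp only: connected_component_eq_empty) simp
    show "open ?H" using \<open>closed X\<close> by (simp add: open_connected_component open_Compl)
    show "?H \<inter> X = {}" using connected_component_subset[of "- X" x] by blast
    show "frontier ?H \<subseteq> X"
      by (rule frontier_of_components_closed_complement[OF \<open>closed X\<close> comp])
  qed (use x in auto)
  then show ?thesis by (rule that)
qed

text \<open>An unbounded component of the complement of \<open>X\<close> avoids \<open>Y\<close>, so
  it sits inside a component of the complement of \<open>Y\<close>, which is then unbounded
  too.\<close>

lemma outside_antimono_if_disjoint:
  assumes "Y \<inter> outside X = {}"
  shows "outside X \<subseteq> outside Y"
proof
  fix x assume x: "x \<in> outside X"
  let ?C = "connected_component_set (- X) x"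
  have "\<not> bounded ?C" and "x \<notin> X" using x by (auto simp: outside_def)
  have "?C \<subseteq> outside X" using outside_same_component x by fastforce
  then have "?C \<subseteq> - Y" using assms by blast
  moreover have "x \<in> ?C" using \<open>x \<notin> X\<close> by simp
  ultimately have "?C \<subseteq> connected_component_set (- Y) x"
    by (intro connected_component_maximal) auto
  then show "x \<in> outside Y"
    using \<open>\<not> bounded ?C\<close> bounded_subset unfolding outside by blast
qed

subsection \<open>Finite unions of convex sets\<close>

text \<open>A component contains every member of \<open>F\<close> that it meets, so one chosen point
  per member reaches all components.\<close>

lemma finite_components_Union_connected:
  assumes "finite F" "\<And>C. C \<in> F \<Longrightarrow> connected C"
  shows "finite (components (\<Union>F))"
proof (rule finite_subset)
  let ?c = "\<lambda>C. connected_component_set (\<Union>F) (SOME x. x \<in> C)"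
  show "finite (?c ` F)" using assms(1) by simp
  show "components (\<Union>F) \<subseteq> ?c ` F"
  proof
    fix D assume "D \<in> components (\<Union>F)"
    then obtain x where x: "x \<in> \<Union>F" "D = connected_component_set (\<Union>F) x"
      by (auto simp: components_def)
    then obtain C where C: "C \<in> F" "x \<in> C" by blast
    then have "(SOME x. x \<in> C) \<in> C" by (metis someI)
    then have "connected_component (\<Union>F) x (SOME x. x \<in> C)"
      using C assms(2)[OF C(1)] unfolding connected_component_def by blast
    then show "D \<in> ?c ` F" using x(2) C(1) connected_component_eq by fastforce
  qed
qed

text \<open>The complement of one polyhedron is a finite union of open half-spaces, and distributing
  intersections over unions keeps the pieces convex and finite in number. This is what leaves only
  finitely many holes.\<close>

lemma Compl_Union_polyhedra:
  fixes T :: "'a::euclidean_space set set"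
  assumes "finite T" "\<And>S. S \<in> T \<Longrightarrow> polyhedron S"
  shows "\<exists>F. finite F \<and> (\<forall>C\<in>F. convex C) \<and> - \<Union>T = \<Union>F"
  using assms
proof (induction T)
  case empty
  show ?case by (rule exI[of _ "{UNIV}"]) auto
next
  case (insert S T)
  then obtain F where F: "finite F" "\<And>C. C \<in> F \<Longrightarrow> convex C" "- \<Union>T = \<Union>F" by auto
  obtain G where G: "finite G" "S = \<Inter>G"
      "\<And>h. h \<in> G \<Longrightarrow> \<exists>a b. a \<noteq> 0 \<and> h = {x. a \<bullet> x \<le> b}"
    using insert.prems[of S] unfolding polyhedron_def by auto
  have "convex (- h)" if h: "h \<in> G" for h
  proof -
    obtain a b where "h = {x. a \<bullet> x \<le> b}" using G(3)[OF h] by blast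
    then have "- h = {x. a \<bullet> x > b}" by auto
    then show ?thesis by (simp add: convex_halfspace_gt)
  qed
  then have "\<forall>C\<in>(\<lambda>(h, C). - h \<inter> C) ` (G \<times> F). convex C"
    using F(2) by (auto intro: convex_Int)
  moreover have "- \<Union>(insert S T) = \<Union>((\<lambda>(h, C). - h \<inter> C) ` (G \<times> F))"
  proof -
    have "- \<Union>(insert S T) = - S \<inter> - \<Union>T" by blast
    also have "\<dots> = (\<Union>h\<in>G. - h) \<inter> \<Union>F" unfolding F(3) G(2) by auto
    finally show ?thesis by auto
  qed
  ultimately show ?case using F(1) G(1) by (intro exI conjI) auto
qed

text \<open>Pieces of lower dimension are excluded so that the set lies in the closure of its
  interior and almost every ray meeting a piece also meets the interior of that piece.\<close>

definition fat_union :: "'a::euclidean_space set \<Rightarrow> bool" where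
  "fat_union X \<longleftrightarrow> (\<exists>T. finite T \<and> (\<forall>S\<in>T. convex S \<and> interior S \<noteq> {}) \<and> X = \<Union>T)"

lemma (in similarity) fat_union_image:
  assumes "fat_union X" shows "fat_union (g ` X)"
proof -
  obtain T where "finite T" "\<forall>S\<in>T. convex S \<and> interior S \<noteq> {}" "X = \<Union>T"
    using assms unfolding fat_union_def by blast
  then have "finite ((`) g ` T) \<and> (\<forall>S\<in>(`) g ` T. convex S \<and> interior S \<noteq> {}) \<and>
      g ` X = \<Union>((`) g ` T)"
    by (auto simp: convex_image interior_image)
  then show ?thesis unfolding fat_union_def by (rule exI)
qed

lemma fat_union_subset_closure_interior:
  assumes "fat_union X" shows "X \<subseteq> closure (interior X)"
proof
  fix x assume "x \<in> X"
  then obtain S where "x \<in> S" "convex S" "interior S \<noteq> {}" "S \<subseteq> X"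
    using assms unfolding fat_union_def by blast
  then show "x \<in> closure (interior X)"
    by (metis closure_mono closure_subset convex_closure_interior interior_mono subsetD)
qed

text \<open>Convex pieces with empty interior are negligible. What the fat pieces leave uncovered in
  the interior of the union is open and negligible, hence empty; by density the fat pieces already
  cover everything.\<close>

lemma fat_unionI:
  fixes T :: "'a::euclidean_space set set"
  assumes "finite T" "\<And>S. S \<in> T \<Longrightarrow> convex S" "\<And>S. S \<in> T \<Longrightarrow> closed S"
    and dense: "\<Union>T \<subseteq> closure (interior (\<Union>T))"
  shows "fat_union (\<Union>T)"
proof -
  let ?F = "{S \<in> T. interior S \<noteq> {}}" and ?N = "{S \<in> T. interior S = {}}"
  have "closed (\<Union>?F)" using assms by (auto intro: closed_Union)
  have "negligible (\<Union>?N)"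
  proof (rule negligible_Union)
    fix S assume "S \<in> ?N"
    then have "S \<subseteq> frontier S" "convex S"
      using assms closure_subset by (auto simp: frontier_def)
    then show "negligible S" using negligible_convex_frontier negligible_subset by blast
  qed (use assms in auto)
  moreover have "interior (\<Union>T) - \<Union>?F \<subseteq> \<Union>?N" using interior_subset by fastforce
  ultimately have "negligible (interior (\<Union>T) - \<Union>?F)" by (rule negligible_subset)
  moreover have "open (interior (\<Union>T) - \<Union>?F)"
    using \<open>closed (\<Union>?F)\<close> by (intro open_Diff open_interior)
  ultimately have "interior (\<Union>T) - \<Union>?F = {}"
    using open_not_negligible by metis
  then have "closure (interior (\<Union>T)) \<subseteq> \<Union>?F"
    by (intro closure_minimal \<open>closed (\<Union>?F)\<close>) auto
  then have "\<Union>T = \<Union>?F" using dense by blast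
  then show ?thesis unfolding fat_union_def
    using assms by (intro exI[of _ ?F]) auto
qed

text \<open>The set is the cone with apex \<open>u\<close> over \<open>S\<close>, formed by the
  rescalings of \<open>S\<close> from \<open>u\<close> by all positive factors.\<close>

lemma convex_shadow:
  assumes "convex S"
  shows "convex {y. \<exists>s>0. u + s *\<^sub>R (y - u) \<in> S}"
proof (rule convexI)
  fix x y and a b :: real
  assume "x \<in> {y. \<exists>s>0. u + s *\<^sub>R (y - u) \<in> S}" "y \<in> {y. \<exists>s>0. u + s *\<^sub>R (y - u) \<in> S}"
  then obtain s t where st: "s > 0" "t > 0" "u + s *\<^sub>R (x - u) \<in> S" "u + t *\<^sub>R (y - u) \<in> S"
    by blast
  assume ab: "0 \<le> a" "0 \<le> b" "a + b = 1"
  \<comment> \<open>With weights \<open>a / s\<close> and \<open>b / t\<close> divided by their sum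
    \<open>w\<close>, the combination of the two points of \<open>S\<close> lies on the ray from
    \<open>u\<close> through \<open>a *\<^sub>R x + b *\<^sub>R y\<close>, at parameter
    \<open>1 / w\<close>.\<close>
  define w where "w = a / s + b / t"
  have "a > 0 \<or> b > 0" using ab by linarith
  then have w: "w > 0" unfolding w_def using st ab
    by (metis add_nonneg_pos add_pos_nonneg divide_nonneg_pos divide_pos_pos)
  have sum1: "a / s / w + b / t / w = 1"
    using w unfolding add_divide_distrib[symmetric] w_def[symmetric] by simp
  have "(a / s / w) *\<^sub>R (u + s *\<^sub>R (x - u)) + (b / t / w) *\<^sub>R (u + t *\<^sub>R (y - u)) \<in> S"
    using convexD[OF assms st(3,4) _ _ sum1] ab st w by simp
  also have "(a / s / w) *\<^sub>R (u + s *\<^sub>R (x - u)) + (b / t / w) *\<^sub>R (u + t *\<^sub>R (y - u))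
      = (a / s / w + b / t / w) *\<^sub>R u + ((a / w) *\<^sub>R (x - u) + (b / w) *\<^sub>R (y - u))"
    using st by (simp add: scaleR_add_right scaleR_add_left)
  also have "\<dots> = u + (1 / w) *\<^sub>R (a *\<^sub>R (x - u) + b *\<^sub>R (y - u))"
    unfolding sum1 by (simp add: scaleR_add_right)
  also have "a *\<^sub>R (x - u) + b *\<^sub>R (y - u) = a *\<^sub>R x + b *\<^sub>R y - (a + b) *\<^sub>R u"
    by (simp add: algebra_simps)
  also have "\<dots> = a *\<^sub>R x + b *\<^sub>R y - u" using ab by simp
  finally show "a *\<^sub>R x + b *\<^sub>R y \<in> {y. \<exists>s>0. u + s *\<^sub>R (y - u) \<in> S}"
    using w by (intro CollectI exI[of _ "1 / w"]) simp
qed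

text \<open>Rays that only graze \<open>S\<close> lie on the frontier of the open convex cone over
  its interior, and frontiers of convex sets are negligible.\<close>

lemma negligible_tangent_rays:
  fixes S :: "'a::euclidean_space set"
  assumes "convex S" "interior S \<noteq> {}"
  shows "negligible ({y. \<exists>s>0. u + s *\<^sub>R (y - u) \<in> S} - {y. \<exists>s>0. u + s *\<^sub>R (y - u) \<in> interior S})"
    (is "negligible (?K - ?L)")
proof -
  have "?L = (\<Union>s\<in>{0<..}. (\<lambda>y. u + s *\<^sub>R (y - u)) -` interior S)" by auto
  moreover have "open ((\<lambda>y. u + s *\<^sub>R (y - u)) -` interior S)" for s
    by (intro open_vimage continuous_intros open_interior)
  ultimately have "open ?L" by (simp add: open_UN)
  have "?K \<subseteq> closure ?L"
  proof
    fix y assume "y \<in> ?K"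
    then obtain s where s: "s > 0" "u + s *\<^sub>R (y - u) \<in> S" by blast
    \<comment> \<open>This dilation from \<open>u\<close> takes the point of \<open>S\<close> on the
      ray back to \<open>y\<close>, and takes the interior of \<open>S\<close> into the cone
      \<open>?L\<close>.\<close>
    let ?f = "\<lambda>z. u + (1 / s) *\<^sub>R (z - u)"
    have "u + s *\<^sub>R (y - u) \<in> closure (interior S)"
      using s assms convex_closure_interior closure_subset by blast
    moreover have "y = ?f (u + s *\<^sub>R (y - u))" using s by simp
    ultimately have "y \<in> ?f ` closure (interior S)" by blast
    also have "\<dots> \<subseteq> closure ?L"
    proof (rule image_closure_subset)
      show "continuous_on (closure (interior S)) ?f" by (intro continuous_intros)
      have "?f ` interior S \<subseteq> ?L" using s by force
      then show "?f ` interior S \<subseteq> closure ?L" using closure_subset by blast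
    qed simp
    finally show "y \<in> closure ?L" .
  qed
  then have "?K - ?L \<subseteq> frontier ?L"
    using \<open>open ?L\<close> by (auto simp: frontier_def interior_open)
  moreover have "negligible (frontier ?L)"
    by (intro negligible_convex_frontier convex_shadow convex_interior assms)
  ultimately show ?thesis using negligible_subset by blast
qed

text \<open>A ray from \<open>U\<close> that is tangent to none of the convex pieces must, where it first leaves \<open>U\<close>,
  enter the interior of a piece of \<open>X\<close> and of a piece of \<open>Y\<close> simultaneously.\<close>

lemma fat_unions_common_frontier:
  fixes X Y U :: "'a::euclidean_space set"
  assumes "fat_union X" "fat_union Y" "open U" "U \<noteq> {}" "interior (- U) \<noteq> {}"
    and disj: "U \<inter> X = {}" "U \<inter> Y = {}" and fr: "frontier U \<subseteq> X \<inter> Y"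
  shows "interior X \<inter> interior Y \<noteq> {}"
proof -
  obtain T1 where T1: "finite T1" "\<forall>S\<in>T1. convex S \<and> interior S \<noteq> {}" "X = \<Union>T1"
    using assms unfolding fat_union_def by blast
  obtain T2 where T2: "finite T2" "\<forall>S\<in>T2. convex S \<and> interior S \<noteq> {}" "Y = \<Union>T2"
    using assms unfolding fat_union_def by blast
  obtain u where "u \<in> U" using assms by blast
  define B where "B S = {y. \<exists>s>0. u + s *\<^sub>R (y - u) \<in> S}" for S
  have "negligible (\<Union>S\<in>T1 \<union> T2. B S - B (interior S))"
    unfolding B_def using T1 T2 by (intro negligible_Union) (auto intro!: negligible_tangent_rays)
  \<comment> \<open>Points on tangent rays form a null set, so the nonempty open set
    \<open>interior (- U)\<close> contains a point \<open>y\<close> whose ray is tangent to no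
    piece.\<close>
  then have "\<not> interior (- U) \<subseteq> (\<Union>S\<in>T1 \<union> T2. B S - B (interior S))"
    using negligible_subset open_not_negligible assms open_interior by blast
  then obtain y where y: "y \<in> interior (- U)"
      "\<And>S. S \<in> T1 \<union> T2 \<Longrightarrow> y \<in> B S \<Longrightarrow> y \<in> B (interior S)" by blast
  define \<gamma> where "\<gamma> s = u + s *\<^sub>R (y - u)" for s
  have cont: "continuous_on A \<gamma>" for A unfolding \<gamma>_def by (intro continuous_intros)
  \<comment> \<open>\<open>t\<close> will be the first exit time from \<open>U\<close>. It is
    attained because \<open>A\<close> is closed, and \<open>A\<close> contains 1 because the ray is
    at \<open>y\<close> then.\<close>
  define A where "A = {0..} \<inter> \<gamma> -` (- U)"
  define t where "t = Inf A"
  have "closed A" unfolding A_def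
    using assms(3) cont[of UNIV] by (intro closed_Int closed_vimage) auto
  have bdd: "bdd_below A" unfolding A_def by (intro bdd_belowI[of _ 0]) auto
  have "1 \<in> A" using y(1) interior_subset by (force simp: A_def \<gamma>_def)
  then have "t \<in> A" unfolding t_def using \<open>closed A\<close> bdd by (intro closed_contains_Inf) auto
  then have pU: "\<gamma> t \<notin> U" and "t \<ge> 0" by (auto simp: A_def)
  have "t \<noteq> 0" using pU \<open>u \<in> U\<close> by (auto simp: \<gamma>_def)
  with \<open>t \<ge> 0\<close> have "t > 0" by simp
  have before: "\<gamma> s \<in> U" if "0 \<le> s" "s < t" for s
    using that cInf_lower[of s A] bdd by (force simp: A_def t_def)
  have pcl: "\<gamma> t \<in> closure U"
  proof -
    have "\<gamma> ` closure {0..<t} \<subseteq> closure U"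
      by (rule image_closure_subset[OF cont]) (use before closure_subset[of U] in auto)
    then show ?thesis using \<open>t > 0\<close> by auto
  qed
  then have "\<gamma> t \<in> frontier U" using pU assms(3) by (simp add: frontier_def interior_open)
  then have pXY: "\<gamma> t \<in> X" "\<gamma> t \<in> Y" using fr by auto
  \<comment> \<open>The ray meets the interior of \<open>S\<close> at some \<open>s0\<close>. Since
    \<open>S\<close> is disjoint from \<open>U\<close>, this cannot happen up to time
    \<open>t\<close>; convexity then puts everything after \<open>t\<close> up to \<open>s0\<close>
    into the interior.\<close>
  have enter: "\<exists>s0>t. \<forall>s. t < s \<and> s \<le> s0 \<longrightarrow> \<gamma> s \<in> interior S"
    if S: "S \<in> T1 \<union> T2" "\<gamma> t \<in> S" for S
  proof -
    have "convex S" using S T1 T2 by blast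
    have SU: "S \<inter> U = {}" using S T1 T2 disj by blast
    have "y \<in> B S" using S \<open>t > 0\<close> by (auto simp: B_def \<gamma>_def)
    then obtain s0 where s0: "s0 > 0" "\<gamma> s0 \<in> interior S"
      using y(2)[OF S(1)] by (auto simp: B_def \<gamma>_def)
    have "s0 \<noteq> t"
    proof
      assume "s0 = t"
      then have "interior S \<inter> closure U \<noteq> {}" using s0 pcl by blast
      then have "interior S \<inter> U \<noteq> {}" by (simp add: open_Int_closure_eq_empty)
      then show False using SU interior_subset by blast
    qed
    moreover have "\<not> s0 < t" using before[of s0] s0 SU interior_subset[of S] by fastforce
    ultimately have "t < s0" by simp
    moreover have "\<gamma> s \<in> interior S" if "t < s" "s \<le> s0" for s
    proof -
      define e where "e = (s - t) / (s0 - t)"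
      have e: "0 < e" "e \<le> 1" "e * (s0 - t) = s - t" using that by (auto simp: e_def)
      have "\<gamma> t - e *\<^sub>R (\<gamma> t - \<gamma> s0) = u + (t + e * (s0 - t)) *\<^sub>R (y - u)"
        by (simp add: \<gamma>_def algebra_simps)
      also have "\<dots> = \<gamma> s" using e by (simp add: \<gamma>_def)
      finally show ?thesis
        using mem_interior_convex_shrink[OF \<open>convex S\<close> s0(2) S(2) e(1,2)] by simp
    qed
    ultimately show ?thesis by blast
  qed
  obtain S1 S2 where S: "S1 \<in> T1" "\<gamma> t \<in> S1" "S2 \<in> T2" "\<gamma> t \<in> S2"
    using pXY T1 T2 by blast
  obtain s1 where s1: "s1 > t" "\<forall>s. t < s \<and> s \<le> s1 \<longrightarrow> \<gamma> s \<in> interior S1"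
    using enter[of S1] S by blast
  obtain s2 where s2: "s2 > t" "\<forall>s. t < s \<and> s \<le> s2 \<longrightarrow> \<gamma> s \<in> interior S2"
    using enter[of S2] S by blast
  have "\<gamma> (min s1 s2) \<in> interior S1 \<inter> interior S2" using s1 s2 by simp
  moreover have "interior S1 \<subseteq> interior X" "interior S2 \<subseteq> interior Y"
    using S T1 T2 by (auto intro!: interior_mono)
  ultimately show ?thesis by blast
qed

subsection \<open>Tiles\<close>

text \<open>These properties are preserved by similarities, so all tiles inherit them from
  \<open>X\<close>. Connectedness is asked of the interior because that is what confines a
  neighbouring tile to a single hole.\<close>

definition tile_body :: "'a::euclidean_space set \<Rightarrow> bool" where
  "tile_body X \<longleftrightarrow> compact X \<and> connected (interior X) \<and> interior X \<noteq> {} \<and> fat_union X"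

lemma (in similarity) tile_body_image: "tile_body X \<Longrightarrow> tile_body (g ` X)"
  unfolding tile_body_def
  by (simp add: compact_image connected_image interior_image fat_union_image)

lemma interior_disjoint_fat_union:
  assumes "fat_union X" "interior X \<inter> interior Y = {}"
  shows "X \<inter> interior Y = {}"
proof -
  have "interior Y \<inter> closure (interior X) = {}"
    using assms(2) open_Int_closure_eq_empty[of "interior Y" "interior X"] by blast
  then show ?thesis using fat_union_subset_closure_interior[OF assms(1)] by blast
qed

text \<open>Filling in all holes of \<open>Y = f X\<close> gives a set isometric to, and inside, the filled \<open>X\<close>,
  hence equal to it; so \<open>X\<close> and \<open>Y\<close> would have the same outer boundary.\<close>

lemma congruent_tile_not_in_hole:
  fixes X Y :: "'a::euclidean_space set"
  assumes "similarity f 1" "Y = f ` X" "tile_body X" "tile_body Y"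
    and disj: "interior X \<inter> interior Y = {}" and "hole X H"
  shows "H \<inter> Y = {}"
proof (rule ccontr)
  assume "H \<inter> Y \<noteq> {}"
  interpret similarity f 1 by fact
  have X: "compact X" "closed X" "bounded X" "fat_union X" "interior X \<noteq> {}"
    and Y: "compact Y" "closed Y" "fat_union Y" "connected (interior Y)"
    using assms compact_imp_closed compact_imp_bounded unfolding tile_body_def by auto
  have "open H" using assms unfolding hole_def by blast
  have Ycl: "Y \<subseteq> closure (interior Y)" by (rule fat_union_subset_closure_interior[OF Y(3)])
  then have "interior Y \<inter> H \<noteq> {}"
    using \<open>H \<inter> Y \<noteq> {}\<close> open_Int_closure_eq_empty[OF \<open>open H\<close>, of "interior Y"] by blast
  \<comment> \<open>The interior of \<open>Y\<close> avoids all of \<open>X\<close>, not just its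
    interior, because \<open>X\<close> is fat; being connected, it cannot leave the hole.\<close>
  then have "interior Y \<subseteq> H"
    using hole_connected_subset[OF \<open>hole X H\<close> Y(4)] interior_disjoint_fat_union[OF X(4) disj]
    by blast
  then have "Y \<subseteq> closure H" using Ycl closure_mono by blast
  moreover have "outside X \<inter> closure H = {}"
    using hole_Int_outside[OF \<open>hole X H\<close>] open_outside[OF X(2)]
    by (metis Int_commute open_Int_closure_eq_empty)
  ultimately have "outside X \<subseteq> outside Y" by (intro outside_antimono_if_disjoint) blast
  moreover have fill: "f ` (- outside X) = - outside Y"
    unfolding assms(2) outside_image image_Compl ..
  moreover have "compact (- outside X)"
    by (metis X(1) X(2) X(3) bounded_Un bounded_inside closed_Compl compact_eq_bounded_closed
        open_outside union_with_inside)
  ultimately have "f ` (- outside X) = - outside X"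
    by (intro compact_isometry_into_imp_onto) (auto simp: dist_image)
  then have eq: "outside Y = outside X" using fill by simp
  \<comment> \<open>The common outer region serves as \<open>U\<close> in
    \<open>fat_unions_common_frontier\<close>, and the resulting overlap contradicts
    \<open>disj\<close>.\<close>
  have "frontier (outside X) \<subseteq> X \<inter> Y"
    using frontier_outside_subset[OF X(2)] frontier_outside_subset[OF Y(2)] eq by auto
  moreover have "interior (- outside X) \<noteq> {}"
    using X(5) interior_mono[of X "- outside X"] outside_no_overlap[of X] by blast
  ultimately have "interior X \<inter> interior Y \<noteq> {}"
    using outside_no_overlap[of X] outside_no_overlap[of Y] eq X Y
    by (intro fat_unions_common_frontier[of X Y "outside X"] open_outside
        outside_bounded_nonempty) auto
  then show False using disj by blast
qed

text \<open>The descent rests on two facts: finitely many components give a hole of least diameter,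
  and more than one tile forces the ratio \<open>r\<close> below 1.\<close>

lemma tiled_imp_connected_Compl:
  fixes X :: "'a::euclidean_space set"
  assumes X: "tile_body X" "finite (components (- X))" and dim: "2 \<le> DIM('a)"
    and Xs: "X = (\<Union>i\<in>I. Xs i)" "i0 \<in> I" "I \<noteq> {i0}"
    and disj: "\<And>i j. i \<in> I \<Longrightarrow> j \<in> I \<Longrightarrow> i \<noteq> j \<Longrightarrow> interior (Xs i) \<inter> interior (Xs j) = {}"
    and cong: "\<And>i. i \<in> I \<Longrightarrow> \<exists>f. similarity f 1 \<and> Xs i = f ` Xs i0"
    and sim: "similarity g r" "Xs i0 = g ` X"
  shows "connected (- X)"
proof (rule ccontr)
  assume "\<not> connected (- X)"
  interpret similarity g r by fact
  have "compact X" "interior X \<noteq> {}" using X unfolding tile_body_def by auto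
  have body: "tile_body (Xs i)" if "i \<in> I" for i
    using cong[OF that] tile_body_image[OF X(1)] similarity.tile_body_image sim(2) by metis
  \<comment> \<open>For a ratio of at least 1, comparing diameters gives \<open>r = 1\<close>. Then
    \<open>g\<close> maps the compact set \<open>X\<close> onto itself, so the tile
    \<open>Xs i0\<close> is all of \<open>X\<close> and any other tile has empty interior.\<close>
  have "r < 1"
  proof (rule ccontr)
    assume "\<not> r < 1"
    have "bounded X" by (simp add: \<open>compact X\<close> compact_imp_bounded)
    obtain a b where ab: "a \<in> X" "b \<in> X" "a \<noteq> b"
    proof -
      obtain a where "a \<in> interior X" using \<open>interior X \<noteq> {}\<close> by blast
      moreover have "X \<noteq> {a}"
        using \<open>interior X \<noteq> {}\<close> by (metis interior_singleton)
      ultimately show ?thesis using that interior_subset by blast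
    qed
    then have "0 < dist a b" by simp
    also have "dist a b \<le> diameter X"
      by (rule diameter_bounded_bound[OF \<open>bounded X\<close> ab(1,2)])
    finally have "0 < diameter X" .
    have "g ` X \<subseteq> X" using Xs sim(2) by blast
    then have "r * diameter X \<le> diameter X"
      using diameter_subset \<open>bounded X\<close> diameter_image by metis
    with \<open>0 < diameter X\<close> \<open>\<not> r < 1\<close> have "r = 1" by simp
    then have "g ` X = X"
      using compact_isometry_into_imp_onto[OF \<open>compact X\<close> \<open>g ` X \<subseteq> X\<close>] dist_image by simp
    obtain j where j: "j \<in> I" "j \<noteq> i0" using Xs by blast
    have "interior (Xs j) \<subseteq> interior X" using Xs(1) j by (intro interior_mono) blast
    then have "interior (Xs j) = {}"
      using disj[OF Xs(2) j(1)] j(2) sim(2) \<open>g ` X = X\<close> by auto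
    then show False using body[OF j(1)] unfolding tile_body_def by blast
  qed
  have "finite {H. hole X H}"
    by (rule finite_subset[OF _ X(2)]) (auto intro: hole_in_components)
  moreover have "{H. hole X H} \<noteq> {}"
    using hole_exists[OF \<open>compact X\<close> dim \<open>\<not> connected (- X)\<close>] by blast
  ultimately obtain H where H: "hole X H" "\<And>H'. hole X H' \<Longrightarrow> diameter H \<le> diameter H'"
    using ex_min_if_finite[of "diameter ` {H. hole X H}"]
    by (metis (no_types, lifting) Collect_empty_eq finite_imageI image_iff image_is_empty
        linorder_not_less mem_Collect_eq)
  have gH: "hole (Xs i0) (g ` H)" using hole_image[OF H(1)] sim(2) by simp
  \<comment> \<open>The reference tile avoids its own hole, and every other tile avoids it by
    \<open>congruent_tile_not_in_hole\<close>. So this smaller set is a hole of \<open>X\<close>,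
    against minimality.\<close>
  have "g ` H \<inter> Xs j = {}" if j: "j \<in> I" for j
  proof (cases "j = i0")
    case True
    then show ?thesis using gH unfolding hole_def by blast
  next
    case False
    obtain f where "similarity f 1" "Xs j = f ` Xs i0" using cong[OF j] by blast
    then show ?thesis
      using congruent_tile_not_in_hole body Xs(2) j disj[OF Xs(2) j] False gH by metis
  qed
  then have "g ` H \<inter> X = {}" using Xs(1) by blast
  moreover have "Xs i0 \<subseteq> X" using Xs by blast
  ultimately have "hole X (g ` H)" using gH unfolding hole_def by blast
  then have "diameter H \<le> diameter (g ` H)" by (rule H(2))
  moreover have "bounded H" "open H" "H \<noteq> {}" using H(1) unfolding hole_def by auto
  moreover have "0 < diameter H"
  proof -
    obtain x where "x \<in> H" using \<open>H \<noteq> {}\<close> by blast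
    moreover have "H \<noteq> {x}" using \<open>open H\<close> not_open_singleton by blast
    ultimately obtain y where "y \<in> H" "y \<noteq> x" by blast
    then have "0 < dist x y" by simp
    also have "\<dots> \<le> diameter H"
      by (rule diameter_bounded_bound[OF \<open>bounded H\<close> \<open>x \<in> H\<close> \<open>y \<in> H\<close>])
    finally show ?thesis .
  qed
  ultimately show False using \<open>r < 1\<close> diameter_image by simp
qed

subsection \<open>Manifolds with boundary\<close>

lemma image_subset_closure_image:
  fixes f :: "'a::first_countable_topology \<Rightarrow> 'b::first_countable_topology"
  assumes "continuous_on V f" "V \<subseteq> closure P" "P \<subseteq> V"
  shows "f ` V \<subseteq> closure (f ` P)"
proof
  fix z assume "z \<in> f ` V"
  then obtain y where y: "y \<in> V" "z = f y" by blast
  then have "y \<in> closure P" using assms(2) by blast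
  then obtain s where s: "\<And>n. s n \<in> P" "s \<longlonglongrightarrow> y" unfolding closure_sequential by blast
  then have "\<forall>\<^sub>F n in sequentially. s n \<in> V" using assms(3) by (simp add: subset_iff)
  from continuous_on_tendsto_compose[OF assms(1) s(2) y(1) this]
  have "(\<lambda>n. f (s n)) \<longlonglongrightarrow> z" unfolding y(2) .
  with s(1) show "z \<in> closure (f ` P)"
    unfolding closure_sequential by (intro exI[of _ "\<lambda>n. f (s n)"]) auto
qed

text \<open>Charts are used only through an open connected \<open>W\<close> that is dense in a
  neighbourhood \<open>U\<close> of \<open>x\<close>. It is the image of a half-ball without its
  flat face, and invariance of domain makes it open in space.\<close>

lemma manifold3_chart:
  assumes "manifold3 X" "x \<in> X"
  obtains U W where "openin (top_of_set X) U" "x \<in> U" "open W" "connected W" "W \<subseteq> U"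
    "U \<subseteq> closure W"
proof -
  obtain U0 V0 where U0: "openin (top_of_set X) U0" "x \<in> U0"
      "openin (top_of_set half_space3) V0" "U0 homeomorphic V0"
    using assms unfolding manifold3_def by metis
  then obtain h k where hk: "homeomorphism U0 V0 h k" unfolding homeomorphic_def by blast
  obtain Q where Q: "open Q" "V0 = half_space3 \<inter> Q" using U0(3) by (auto simp: openin_open)
  have "h x \<in> V0" using hk U0(2) by (auto simp: homeomorphism_def)
  then obtain e where e: "e > 0" "ball (h x) e \<subseteq> Q"
    using Q open_contains_ball by (metis IntD2)
  \<comment> \<open>If \<open>h x\<close> is off the boundary plane, the ball may still cross that
    plane; \<open>?P\<close> is convex and dense in \<open>?V\<close> in either case.\<close>
  let ?V = "half_space3 \<inter> ball (h x) e" and ?P = "{y :: real^3. y $ 1 > 0} \<inter> ball (h x) e"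
  have "?V \<subseteq> V0" using e Q by blast
  have PV: "?P \<subseteq> ?V" by (auto simp: half_space3_def)
  have contk: "continuous_on V0 k" using hk by (simp add: homeomorphism_def)
  have injk: "inj_on k V0" using hk by (metis homeomorphism_apply2 inj_on_inverseI)
  have "openin (top_of_set half_space3) ?V" by (simp add: openin_open_Int)
  then have "openin (top_of_set V0) ?V"
    using \<open>?V \<subseteq> V0\<close> U0(3) by (meson openin_subset_trans openin_imp_subset)
  then have "openin (top_of_set U0) (k ` ?V)"
    using hk homeomorphism_imp_open_map homeomorphism_symD by blast
  then have 1: "openin (top_of_set X) (k ` ?V)" using U0(1) openin_trans by blast
  have 2: "x \<in> k ` ?V"
    using \<open>h x \<in> V0\<close> Q e hk U0(2) by (metis IntE IntI centre_in_ball homeomorphism_apply1 imageI)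
  have "open ?P" by (intro open_Int open_ball open_halfspace_component_gt_cart)
  then have 3: "open (k ` ?P)"
    using contk injk PV \<open>?V \<subseteq> V0\<close>
    by (meson invariance_of_domain continuous_on_subset inj_on_subset subset_trans)
  have "connected ?P"
    using convex_halfspace_gt[of 0 "axis 1 (1::real) :: real^3"]
    by (intro convex_connected convex_Int convex_ball) (simp add: inner_axis' )
  then have 4: "connected (k ` ?P)"
    using contk PV \<open>?V \<subseteq> V0\<close> by (meson connected_continuous_image continuous_on_subset subset_trans)
  have "?V \<subseteq> closure ?P"
    using open_Int_closure_subset[OF open_ball, of "h x" e "{y :: real^3. y $ 1 > 0}"]
    by (simp add: half_space3_def Int_commute)
  have 5: "k ` ?V \<subseteq> closure (k ` ?P)"
  proof -
    have "continuous_on ?V k" using contk \<open>?V \<subseteq> V0\<close> by (rule continuous_on_subset)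
    then show ?thesis
      using \<open>?V \<subseteq> closure ?P\<close> PV by (rule image_subset_closure_image)
  qed
  show ?thesis by (rule that[OF 1 2 3 4 image_mono[OF PV] 5])
qed

lemma manifold3_subset_closure_interior:
  assumes "manifold3 X" shows "X \<subseteq> closure (interior X)"
proof
  fix x assume "x \<in> X"
  obtain U W where UW: "openin (top_of_set X) U" "x \<in> U" "open W" "W \<subseteq> U" "U \<subseteq> closure W"
    using manifold3_chart[OF assms \<open>x \<in> X\<close>] by metis
  then have "W \<subseteq> interior X" using openin_imp_subset[OF UW(1)] by (intro interior_maximal) auto
  then show "x \<in> closure (interior X)" using UW closure_mono by blast
qed

text \<open>If the interior split into two open parts, their closures would cover the connected set
  \<open>X\<close> and share a point \<open>x\<close> of it. The connected dense set
  \<open>W\<close> of a chart at \<open>x\<close> would then meet both parts.\<close>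

lemma manifold3_connected_interior:
  assumes "manifold3 X" "connected X" shows "connected (interior X)"
proof (rule ccontr)
  assume "\<not> connected (interior X)"
  then obtain A B where AB: "open A" "open B" "A \<inter> B \<inter> interior X = {}" "interior X \<subseteq> A \<union> B"
      "A \<inter> interior X \<noteq> {}" "B \<inter> interior X \<noteq> {}"
    unfolding connected_def by blast
  define A' B' where "A' = A \<inter> interior X" and "B' = B \<inter> interior X"
  have opn: "open A'" "open B'" "A' \<inter> B' = {}" "interior X = A' \<union> B'"
    using AB by (auto simp: A'_def B'_def)
  have "X \<subseteq> closure A' \<union> closure B'"
    using manifold3_subset_closure_interior[OF assms(1)] opn(4) by (simp add: closure_Un)
  moreover have "closure A' \<inter> X \<noteq> {}" "closure B' \<inter> X \<noteq> {}"
    using AB(5,6) interior_subset[of X] closure_subset[of A'] closure_subset[of B']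
    unfolding A'_def B'_def by auto
  ultimately have "closure A' \<inter> closure B' \<inter> X \<noteq> {}"
    using assms(2) closed_closure unfolding connected_closed by metis
  then obtain x where x: "x \<in> X" "x \<in> closure A'" "x \<in> closure B'" by blast
  obtain U W where UW: "openin (top_of_set X) U" "x \<in> U" "open W" "connected W" "W \<subseteq> U"
      "U \<subseteq> closure W"
    using manifold3_chart[OF assms(1) x(1)] by metis
  obtain Q where Q: "open Q" "U = X \<inter> Q" using UW(1) by (auto simp: openin_open)
  have W: "W \<subseteq> interior X" using UW Q by (intro interior_maximal) auto
  \<comment> \<open>As \<open>U\<close> is a neighbourhood of \<open>x\<close> in \<open>X\<close>,
    the set \<open>C\<close> meets \<open>U\<close>; being open, it also meets \<open>W\<close>,
    which is dense in \<open>U\<close>.\<close>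
  have meets: "W \<inter> C \<noteq> {}" if C: "open C" "C \<subseteq> interior X" "x \<in> closure C" for C
  proof -
    have "Q \<inter> C \<noteq> {}"
      using C(3) UW(2) Q open_Int_closure_eq_empty[of Q C] by blast
    then have "C \<inter> closure W \<noteq> {}" using C(2) Q(2) UW(6) interior_subset[of X] by auto
    then show ?thesis using open_Int_closure_eq_empty[OF C(1)] by blast
  qed
  have "W \<inter> A' \<noteq> {}" "W \<inter> B' \<noteq> {}" using meets opn x by auto
  then show False using UW(4) W opn unfolding connected_def by blast
qed

section \<open>From polyhedral rep-tiles in space to the connected boundary\<close>

lemma isometry3_imp_similarity: "isometry3 f \<Longrightarrow> similarity f 1"
  by unfold_locales (auto simp: isometry3_def)

theorem theorem4:
  fixes X :: "(real^3) set"
  assumes "rep_tile_3D X"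
  shows "connected (frontier X)"
proof -
  obtain k where k: "k > 1" "rep_tile_index k X"
    and X: "polyhedron3 X" "compact X" "connected X" "manifold3 X"
    using assms unfolding rep_tile_3D_def by blast
  obtain T where T: "finite T" "X = \<Union>T" "\<And>S. S \<in> T \<Longrightarrow> polytope S"
    using X(1) unfolding polyhedron3_def polytope_def by auto
  have "fat_union (\<Union>T)"
    using T manifold3_subset_closure_interior[OF X(4)]
    by (intro fat_unionI) (auto simp: polytope_imp_convex polytope_imp_closed)
  moreover have "interior X \<noteq> {}" using k(2) by (simp add: rep_tile_index_def)
  ultimately have body: "tile_body X"
    using X manifold3_connected_interior by (simp add: tile_body_def T(2))
  obtain F where F: "finite F" "\<forall>C\<in>F. convex C" "- X = \<Union>F"
    using Compl_Union_polyhedra[OF T(1)] T polytope_imp_polyhedron by blast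
  then have fin: "finite (components (- X))"
    using finite_components_Union_connected convex_connected by metis
  obtain Xs where Xs: "X = (\<Union>i<k. Xs i)"
      "\<And>i j. i < k \<Longrightarrow> j < k \<Longrightarrow> i \<noteq> j \<Longrightarrow> interior (Xs i) \<inter> interior (Xs j) = {}"
      "\<And>i j. i < k \<Longrightarrow> j < k \<Longrightarrow> congruent3 (Xs i) (Xs j)"
      "\<And>i. i < k \<Longrightarrow> similar3 (Xs i) X"
    using k(2) unfolding rep_tile_index_def by metis
  obtain f where f: "similarity3 f" "f ` Xs 0 = X"
    using Xs(4)[of 0] k(1) unfolding similar3_def by auto
  then obtain r where "similarity f r" unfolding similarity3_def similarity_def by blast
  \<comment> \<open>The given similarity enlarges the tile \<open>Xs 0\<close> to \<open>X\<close>;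
    its inverse, of ratio \<open>1 / r\<close>, is the contraction used for the descent.\<close>
  then have g: "similarity (inv f) (1 / r)" "Xs 0 = inv f ` X"
    using similarity.inverse similarity.inv_image(1) f(2) by metis+
  have "connected (- X)"
  proof (rule tiled_imp_connected_Compl[OF body fin _ Xs(1) _ _ _ _ g])
    show "{..<k} \<noteq> {0}" using k(1) by (metis lessThan_iff less_numeral_extra(3) n_not_Suc_n
          One_nat_def singletonD zero_neq_one)
    fix i assume "i \<in> {..<k}"
    then show "\<exists>f. similarity f 1 \<and> Xs i = f ` Xs 0"
      using Xs(3)[of 0 i] k(1) isometry3_imp_similarity unfolding congruent3_def by auto
  qed (use k(1) Xs(2) in auto)
  \<comment> \<open>Unicoherence enters here: a connected set with connected complement has
    connected frontier.\<close>
  then show ?thesis by (rule connected_frontier_simple[OF X(3)])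
qed

end
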